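(* The DSONC cone is not closed under multiplication: there exist $n\ge1$, finite sets $A_1,A_2\subset\mathbb{R}^n$ and exponential sums $f_1\in D_{A_1}$, $f_2\in D_{A_2}$ such that the product $f_1\cdot f_2\in\mathbb{R}^{A_1+A_2}$ is not contained in $D_{A_1+A_2}$.
   Context: For a finite set $A\subset\mathbb{R}^n$, $\mathbb{R}^A$ denotes the real vector space of exponential sums $f(x)=\sum_{\alpha\in A}c_\alpha e^{\langle x,\alpha\rangle}$, $x\in\mathbb{R}^n$, with $c_\alpha\in\mathbb{R}$. $A_1+A_2$ denotes the Minkowski sum. For $A^+\subset\mathbb{R}^n$ finite and $\beta\in\mathbb{R}^n$ let $\Lambda(A^+,\beta)=\{\lambda\in\mathbb{R}_{\ge0}^{A^+}:\sum_{\alpha\in A^+}\lambda_\alpha\alpha=\beta,\ \sum_{\alpha\in A^+}\lambda_\alpha=1\}$. For $\beta\in\mathrm{conv}(A^+)\setminus A^+$ let $D_{A^+,\beta}$ be the set of all $f(x)=\sum_{\alpha\in A^+}c_\alpha e^{\langle x,\alpha\rangle}+c_\beta e^{\langle x,\beta\rangle}$ with $c_\alpha\ge0$ for all $\alpha\in A^+$ and such that either $c_\beta\ge0$, or $|c_\beta|\le\prod_{\alpha\in A^+}c_\alpha^{\lambda_\alpha}$ for all $\lambda\in\Lambda(A^+,\beta)$ (convention $0^0=1$). DSONC cone: $D_A\subset\mathbb{R}^A$ is the convex cone generated by the exponential monomials $e^{\langle x,\alpha\rangle}$, $\alpha\in A$, together with all sets $D_{A^+,\beta}$ where $A^+\subseteq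 A$ and $\beta\in A\setminus A^+$ with $\beta\in\mathrm{conv}(A^+)$. *)

theory Defs
  imports
    "HOL-Analysis.Analysis"
    "HOL-Library.Function_Algebras"
    "HOL-Library.Set_Algebras"
begin

text \<open>
  The dimension \<open>n\<close> is existentially quantified in the statement, so it cannot be an index type.
  Instead \<open>\<real>\<^sup>n\<close> is the subspace of \<open>nat \<Rightarrow> real\<close> of sequences vanishing from index \<open>n\<close> on.
  Pointwise scalar multiplication makes function spaces real vector spaces, so that the library's
  \<^const>\<open>convex\<close> and \<^const>\<open>convex_cone\<close> apply both to points and to exponential sums.
\<close>

instantiation "fun" :: (type, real_vector) real_vector
begin

definition scaleR_fun :: "real \<Rightarrow> ('a \<Rightarrow> 'b) \<Rightarrow> 'a \<Rightarrow> 'b"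
  where "scaleR_fun r f = (\<lambda>x. r *\<^sub>R f x)"

instance
  by standard (auto simp: scaleR_fun_def fun_eq_iff scaleR_add_right scaleR_add_left)

end

type_synonym point = "nat \<Rightarrow> real"

definition Rn :: "nat \<Rightarrow> point set"
  where "Rn n = {x. \<forall>i\<ge>n. x i = 0}"

definition inner_Rn :: "nat \<Rightarrow> point \<Rightarrow> point \<Rightarrow> real"
  where "inner_Rn n x y = (\<Sum>i<n. x i * y i)"

text \<open>
  Real functions on \<open>\<real>\<^sup>n\<close> are represented as total functions that are 0 outside \<open>Rn n\<close>. The
  pointwise operations preserve this, and equality of representatives is equality on \<open>\<real>\<^sup>n\<close>.
\<close>

definition exp_monomial :: "nat \<Rightarrow> point \<Rightarrow> point \<Rightarrow> real"
  where "exp_monomial n \<alpha> = (\<lambda>x. if x \<in> Rn n then exp (inner_Rn n x \<alpha>) else 0)"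

definition exp_sums :: "nat \<Rightarrow> point set \<Rightarrow> (point \<Rightarrow> real) set"
  where "exp_sums n A = {\<Sum>\<alpha>\<in>A. c \<alpha> *\<^sub>R exp_monomial n \<alpha> | c. True}"

definition Lambda :: "point set \<Rightarrow> point \<Rightarrow> (point \<Rightarrow> real) set"
  where "Lambda A\<^sub>p \<beta> =
    {l \<in> A\<^sub>p \<rightarrow>\<^sub>E {0..}. (\<Sum>\<alpha>\<in>A\<^sub>p. l \<alpha> *\<^sub>R \<alpha>) = \<beta> \<and> (\<Sum>\<alpha>\<in>A\<^sub>p. l \<alpha>) = 1}"

text \<open>In the library \<open>0 powr 0 = 0\<close>, whereas the cone below uses the convention \<open>0\<^sup>0 = 1\<close>.\<close>

definition rpow :: "real \<Rightarrow> real \<Rightarrow> real"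
  where "rpow c l = (if l = 0 then 1 else c powr l)"

text \<open>The set \<open>D\<close> for one pair \<open>A\<^sub>p\<close>, \<open>\<beta>\<close>; used only for finite \<open>A\<^sub>p\<close> and
  \<open>\<beta> \<in> convex hull A\<^sub>p - A\<^sub>p\<close>.\<close>

definition D_single :: "nat \<Rightarrow> point set \<Rightarrow> point \<Rightarrow> (point \<Rightarrow> real) set"
  where "D_single n A\<^sub>p \<beta> =
    {(\<Sum>\<alpha>\<in>A\<^sub>p. c \<alpha> *\<^sub>R exp_monomial n \<alpha>) + c\<^sub>\<beta> *\<^sub>R exp_monomial n \<beta> | c c\<^sub>\<beta>.
      (\<forall>\<alpha>\<in>A\<^sub>p. 0 \<le> c \<alpha>) \<and>
      (0 \<le> c\<^sub>\<beta> \<or> (\<forall>l\<in>Lambda A\<^sub>p \<beta>. \<bar>c\<^sub>\<beta>\<bar> \<le> (\<Prod>\<alpha>\<in>A\<^sub>p. rpow (c \<alpha>) (l \<alpha>))))}"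

definition DSONC :: "nat \<Rightarrow> point set \<Rightarrow> (point \<Rightarrow> real) set"
  where "DSONC n A = convex_cone hull
    (exp_monomial n ` A \<union>
     \<Union> {D_single n A\<^sub>p \<beta> | A\<^sub>p \<beta>. A\<^sub>p \<subseteq> A \<and> \<beta> \<in> A - A\<^sub>p \<and> \<beta> \<in> convex hull A\<^sub>p})"

end

theory Submission
  imports Defs
begin

text \<open>
  Since \<open>D_single\<close> bounds \<open>\<bar>c\<^sub>\<beta>\<bar>\<close> by \<open>\<Prod>c\<^sub>\<alpha>\<^sup>\<lambda>\<close> rather than by the circuit number
  \<open>\<Prod>(c\<^sub>\<alpha> / \<lambda>\<^sub>\<alpha>)\<^sup>\<lambda>\<close>, the cone is smaller than the one of nonnegative circuit sums, and \<open>1 - y + y\<^sup>2\<close> with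
  \<open>y = e\<^sup>x\<close> lies in it. Its square \<open>1 - 2y + 3y\<^sup>2 - 2y\<^sup>3 + y\<^sup>4\<close> is separated from the
  cone by the linear functional with \<open>y\<^sup>k \<mapsto> v\<^sub>k\<close>, where \<open>v = (4, 4, 1, 4, 4)\<close>: its value there is
  \<open>-5\<close>. On a sum with one negative term the functional is nonnegative, because two exponents
  around \<open>\<beta>\<close> suffice: \<open>v\<^sub>\<beta> c\<^sub>i\<^sup>u c\<^sub>j\<^sup>w \<le> v\<^sub>i c\<^sub>i + v\<^sub>j c\<^sub>j\<close> for \<open>i < \<beta> < j\<close> by AM-GM.
\<close>

declare One_nat_def [simp del]

section \<open>Bounds from two exponents, and AM-GM\<close>

lemma sum_fun_apply: "sum f A x = (\<Sum>a\<in>A. f a x)"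
  for f :: "'a \<Rightarrow> 'b \<Rightarrow> real"
  by (induction A rule: infinite_finite_induct) auto

text \<open>A weight vector supported on \<open>a\<close> and \<open>b\<close> alone already lies in
  \<open>Lambda Ap \<beta>\<close>. All other factors are zeroth powers, equal to 1 even at base 0
  by the convention in \<open>rpow\<close>.\<close>

lemma Lambda_pair_bound:
  assumes "finite Ap" "a \<in> Ap" "b \<in> Ap" "a \<noteq> b"
    and u: "0 < u" "0 < w" "u + w = 1"
    and \<beta>: "u *\<^sub>R a + w *\<^sub>R b = \<beta>"
    and bound: "\<And>l. l \<in> Lambda Ap \<beta> \<Longrightarrow> d \<le> (\<Prod>\<alpha>\<in>Ap. rpow (c \<alpha>) (l \<alpha>))"
  shows "d \<le> c a powr u * c b powr w"
proof -
  define l where "l = (\<lambda>\<alpha>\<in>Ap. if \<alpha> = a then u else if \<alpha> = b then w else 0)"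
  have sub: "{a, b} \<subseteq> Ap"
    using assms by auto
  have "(\<Sum>\<alpha>\<in>Ap. l \<alpha> *\<^sub>R \<alpha>) = (\<Sum>\<alpha>\<in>{a, b}. l \<alpha> *\<^sub>R \<alpha>)"
    using assms(1) sub by (intro sum.mono_neutral_right) (auto simp: l_def)
  moreover have "sum l Ap = sum l {a, b}"
    using assms(1) sub by (intro sum.mono_neutral_right) (auto simp: l_def)
  ultimately have "l \<in> Lambda Ap \<beta>"
    using assms by (auto simp: Lambda_def l_def)
  then have "d \<le> (\<Prod>\<alpha>\<in>Ap. rpow (c \<alpha>) (l \<alpha>))"
    by (rule bound)
  also have "\<dots> = (\<Prod>\<alpha>\<in>{a, b}. rpow (c \<alpha>) (l \<alpha>))"
    using assms(1) sub by (intro prod.mono_neutral_right) (auto simp: l_def rpow_def)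
  also have "\<dots> = c a powr u * c b powr w"
    using assms by (auto simp: l_def rpow_def)
  finally show ?thesis .
qed

lemma D_single_subset_DSONC:
  assumes "Ap \<subseteq> A" "\<beta> \<in> A - Ap" "\<beta> \<in> convex hull Ap"
  shows "D_single n Ap \<beta> \<subseteq> DSONC n A"
  unfolding DSONC_def using assms by (intro subset_trans[OF _ hull_subset]) blast

lemma weighted_am_gm:
  fixes a b u w :: real
  assumes "0 \<le> a" "0 \<le> b" "0 < u" "0 < w" "u + w = 1"
  shows "a powr u * b powr w \<le> u * a + w * b"
  using assms Youngs_inequality_0[of u w a b] by (cases "a = 0 \<or> b = 0") auto

section \<open>Exponents on a line and the separating functional\<close>

definition pt :: "real \<Rightarrow> point"
  where "pt t = (\<lambda>i. if i = 0 then t else 0)"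

lemma pt_in_Rn: "pt t \<in> Rn 1"
  by (simp add: pt_def Rn_def)

lemma pt_eq_iff: "pt s = pt t \<longleftrightarrow> s = t"
  by (auto simp: pt_def fun_eq_iff)

lemma pt_add: "pt s + pt t = pt (s + t)"
  by (auto simp: pt_def fun_eq_iff)

lemma pt_scaleR: "r *\<^sub>R pt t = pt (r * t)"
  by (auto simp: pt_def fun_eq_iff scaleR_fun_def)

lemma inner_Rn_pt: "inner_Rn 1 x (pt t) = x 0 * t"
  by (simp add: inner_Rn_def pt_def One_nat_def)

lemma exp_monomial_pt:
  "exp_monomial 1 (pt (real k)) x = (if x \<in> Rn 1 then exp (x 0) ^ k else 0)"
  by (simp add: exp_monomial_def inner_Rn_pt exp_of_nat2_mult)

lemma exp_monomial_pt_ln: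
  "0 < t \<Longrightarrow> exp_monomial 1 (pt (real k)) (pt (ln t)) = t ^ k"
  by (simp add: exp_monomial_pt pt_in_Rn) (simp add: pt_def)

definition grid :: "point set"
  where "grid = (\<lambda>k. pt (real k)) ` {0..4}"

text \<open>As \<open>pt (real k)\<close> is not in \<open>A\<close>, having no exponent on one side
  puts \<open>A\<close> into the open half-space on the other side. That set is convex, so it would
  contain the hull but not \<open>pt (real k)\<close>.\<close>

lemma grid_convex_hull:
  assumes "A \<subseteq> grid" "pt (real k) \<in> convex hull A" "pt (real k) \<notin> A"
  obtains i j where "i < k" "k < j" "j \<le> 4" "pt (real i) \<in> A" "pt (real j) \<in> A"
proof -
  have "linear (\<lambda>x :: point. x 0)"
    by (rule linearI) (simp_all add: scaleR_fun_def)
  then have convex: "convex {x :: point. real k < x 0}" "convex {x :: point. x 0 < real k}"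
    using convex_linear_vimage[of "\<lambda>x :: point. x 0" "{real k<..}"]
      convex_linear_vimage[of "\<lambda>x :: point. x 0" "{..<real k}"]
    by (simp_all add: vimage_def)
  have "\<exists>i<k. pt (real i) \<in> A"
  proof (rule ccontr)
    assume neg: "\<not> ?thesis"
    have "A \<subseteq> {x. real k < x 0}"
    proof
      fix x assume "x \<in> A"
      with assms(1) obtain i where "x = pt (real i)"
        by (auto simp: grid_def)
      with neg \<open>x \<in> A\<close> assms(3) show "x \<in> {x. real k < x 0}"
        by (auto simp: pt_def) (metis linorder_neqE_nat)
    qed
    from hull_minimal[of A _ convex, OF this] convex assms(2) show False
      by (auto simp: pt_def)
  qed
  moreover have "\<exists>j>k. j \<le> 4 \<and> pt (real j) \<in> A"
  proof (rule ccontr)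
    assume neg: "\<not> ?thesis"
    have "A \<subseteq> {x. x 0 < real k}"
    proof
      fix x assume "x \<in> A"
      with assms(1) obtain i where "x = pt (real i)" "i \<le> 4"
        by (auto simp: grid_def)
      with neg \<open>x \<in> A\<close> assms(3) show "x \<in> {x. x 0 < real k}"
        by (auto simp: pt_def) (metis linorder_neqE_nat)
    qed
    from hull_minimal[of A _ convex, OF this] convex assms(2) show False
      by (auto simp: pt_def)
  qed
  ultimately show thesis
    using that by blast
qed

text \<open>
  The weights invert the Vandermonde matrix of the nodes \<open>e\<^sup>x = 1, \<dots>, 5\<close>, scaled to be
  integers: \<open>y\<^sup>k\<close> is mapped to \<open>8 v\<^sub>k\<close>.
\<close>

definition sep :: "(point \<Rightarrow> real) \<Rightarrow> real"
  where "sep f = - 39 * f (pt (ln 1)) + 236 * f (pt (ln 2)) - 294 * f (pt (ln 3))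
    + 164 * f (pt (ln 4)) - 35 * f (pt (ln 5))"

lemma linear_sep: "linear sep"
  by (rule linearI) (simp_all add: sep_def scaleR_fun_def algebra_simps)

lemma sep_exp_monomial:
  assumes "k \<le> 4"
  shows "sep (exp_monomial 1 (pt (real k))) = (if k = 2 then 8 else 32)"
proof -
  have "k \<in> {0, 1, 2, 3, 4}"
    using assms by auto
  then show ?thesis
    unfolding sep_def by (subst exp_monomial_pt_ln, simp)+ auto
qed

lemma sep_exp_monomial_nonneg: "\<alpha> \<in> grid \<Longrightarrow> 0 \<le> sep (exp_monomial 1 \<alpha>)"
  by (auto simp: grid_def sep_exp_monomial)

lemma sep_pair:
  fixes i j k :: nat and a b :: real
  assumes "i < k" "k < j" "j \<le> 4" "0 \<le> a" "0 \<le> b"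
  defines "v \<equiv> \<lambda>k. sep (exp_monomial 1 (pt (real k)))"
  defines "u \<equiv> (real j - real k) / (real j - real i)"
    and "w \<equiv> (real k - real i) / (real j - real i)"
  shows "v k * (a powr u * b powr w) \<le> a * v i + b * v j"
proof -
  have v: "v m = (if m = 2 then 8 else 32)" if "m \<le> 4" for m
    using that unfolding v_def by (rule sep_exp_monomial)
  have uw: "0 < u" "0 < w" "u + w = 1"
    using assms(1-3) by (simp_all add: u_def w_def flip: add_divide_distrib)
  \<comment> \<open>AM-GM for \<open>x\<close> and \<open>4 * y\<close>, with equality at
    \<open>x = 4 * y\<close>: the ratio 4 between the weights 32 and 8 is the largest that
    works.\<close>
  have half: "4 * (x powr (1/2) * y powr (1/2)) \<le> x + 4 * y" if "0 \<le> x" "0 \<le> y" for x y :: real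
    using that weighted_am_gm[of x "4 * y" "1/2" "1/2"]
    by (simp add: powr_mult powr_half_sqrt real_sqrt_mult)
  \<comment> \<open>An outer exponent 2 leaves room for only one configuration on each side, with
    \<open>u = w = 1/2\<close>. Otherwise both outer weights are 32, no less than
    \<open>v k\<close>.\<close>
  consider "i = 2" "k = 3" "j = 4" | "i = 0" "k = 1" "j = 2" | "i \<noteq> 2" "j \<noteq> 2"
    using assms(1-3) by linarith
  then show ?thesis
  proof cases
    case 1
    then show ?thesis
      using half[OF assms(4,5)] by (simp add: v u_def w_def)
  next
    case 2
    then show ?thesis
      using half[OF assms(5,4)] by (simp add: v u_def w_def mult.commute)
  next
    case 3
    have "a powr u * b powr w \<le> u * a + w * b"
      using assms(4,5) uw by (rule weighted_am_gm)
    also have "\<dots> \<le> 1 * a + 1 * b"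
      using uw assms(4,5) by (intro add_mono mult_right_mono) auto
    finally have "v k * (a powr u * b powr w) \<le> 32 * (a + b)"
      using assms(1-5) by (intro mult_mono) (auto simp: v)
    with 3 assms(1-3) show ?thesis
      by (simp add: v)
  qed
qed

lemma sep_D_single_nonneg:
  assumes "Ap \<subseteq> grid" "\<beta> \<in> grid - Ap" "\<beta> \<in> convex hull Ap" "f \<in> D_single 1 Ap \<beta>"
  shows "0 \<le> sep f"
proof -
  let ?v = "\<lambda>\<alpha>. sep (exp_monomial 1 \<alpha>)"
  from assms(4) obtain c d where
    f: "f = (\<Sum>\<alpha>\<in>Ap. c \<alpha> *\<^sub>R exp_monomial 1 \<alpha>) + d *\<^sub>R exp_monomial 1 \<beta>"
    and c: "\<And>\<alpha>. \<alpha> \<in> Ap \<Longrightarrow> 0 \<le> c \<alpha>"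
    and d: "0 \<le> d \<or> (\<forall>l\<in>Lambda Ap \<beta>. \<bar>d\<bar> \<le> (\<Prod>\<alpha>\<in>Ap. rpow (c \<alpha>) (l \<alpha>)))"
    unfolding D_single_def by blast
  have fin: "finite Ap"
    using assms(1) by (rule finite_subset) (simp add: grid_def)
  have sep_f: "sep f = (\<Sum>\<alpha>\<in>Ap. c \<alpha> * ?v \<alpha>) + d * ?v \<beta>"
    by (simp add: f linear_add[OF linear_sep] linear_sum[OF linear_sep] linear_cmul[OF linear_sep])
  have nonneg: "0 \<le> c \<alpha> * ?v \<alpha>" if "\<alpha> \<in> Ap" for \<alpha>
    using that c assms(1) by (intro mult_nonneg_nonneg sep_exp_monomial_nonneg) auto
  have v\<beta>: "0 \<le> ?v \<beta>"
    using assms(2) by (intro sep_exp_monomial_nonneg) auto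
  show ?thesis
  proof (cases "0 \<le> d")
    case True
    then show ?thesis
      unfolding sep_f using nonneg v\<beta> by (intro add_nonneg_nonneg sum_nonneg) auto
  next
    case False
    from assms(2) obtain k where k: "\<beta> = pt (real k)"
      by (auto simp: grid_def)
    with assms obtain i j where ij: "i < k" "k < j" "j \<le> 4" "pt (real i) \<in> Ap" "pt (real j) \<in> Ap"
      using grid_convex_hull[of Ap k] by auto
    \<comment> \<open>Barycentric coordinates of \<open>k\<close> between \<open>i\<close> and
      \<open>j\<close>.\<close>
    define u w where "u = (real j - real k) / (real j - real i)"
      and "w = (real k - real i) / (real j - real i)"
    have uw: "0 < u" "0 < w" "u + w = 1"
      using ij(1,2) by (simp_all add: u_def w_def flip: add_divide_distrib)
    have "u * real i + w * real j = real k"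
      using ij(1,2) by (simp add: u_def w_def divide_simps) (simp add: algebra_simps)
    then have "\<bar>d\<bar> \<le> c (pt (real i)) powr u * c (pt (real j)) powr w"
      using ij uw d False
      by (intro Lambda_pair_bound[OF fin, where \<beta> = \<beta>]) (auto simp: k pt_eq_iff pt_add pt_scaleR)
    then have "?v \<beta> * \<bar>d\<bar> \<le> ?v \<beta> * (c (pt (real i)) powr u * c (pt (real j)) powr w)"
      using v\<beta> by (rule mult_left_mono)
    also have "\<dots> \<le> (\<Sum>\<alpha>\<in>{pt (real i), pt (real j)}. c \<alpha> * ?v \<alpha>)"
      using sep_pair[OF ij(1-3) c c] ij by (simp add: k u_def w_def pt_eq_iff)
    \<comment> \<open>The two chosen terms already outweigh the negative one; the rest only
      add.\<close>
    also have "\<dots> \<le> (\<Sum>\<alpha>\<in>Ap. c \<alpha> * ?v \<alpha>)"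
      using fin ij nonneg by (intro sum_mono2) auto
    finally show ?thesis
      using False by (simp add: sep_f mult.commute)
  qed
qed

text \<open>The half-space where \<open>sep\<close> is nonnegative is a convex cone, so checking the
  generators suffices.\<close>

lemma sep_DSONC_nonneg:
  assumes "f \<in> DSONC 1 grid"
  shows "0 \<le> sep f"
proof -
  have "convex_cone {f. 0 \<le> sep f}"
    by (simp add: convex_cone_iff linear_0[OF linear_sep] linear_add[OF linear_sep]
        linear_cmul[OF linear_sep])
  then have "DSONC 1 grid \<subseteq> {f. 0 \<le> sep f}"
    unfolding DSONC_def
    by (intro hull_minimal) (auto intro: sep_exp_monomial_nonneg sep_D_single_nonneg)
  with assms show ?thesis
    by auto
qed

section \<open>The witness and its square\<close>

definition trinomial :: "point \<Rightarrow> real"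
  where "trinomial = (\<Sum>\<alpha>\<in>{pt 0, pt 2}. 1 *\<^sub>R exp_monomial 1 \<alpha>) + (-1) *\<^sub>R exp_monomial 1 (pt 1)"

lemma trinomial_apply:
  "trinomial x = (if x \<in> Rn 1 then 1 - exp (x 0) + exp (x 0) ^ 2 else 0)"
  using exp_monomial_pt[of 0 x] exp_monomial_pt[of 1 x] exp_monomial_pt[of 2 x]
  by (simp add: trinomial_def pt_eq_iff scaleR_fun_def)

lemma trinomial_in_DSONC: "trinomial \<in> DSONC 1 {pt 0, pt 1, pt 2}"
proof -
  \<comment> \<open>With both outer coefficients 1, every product over \<open>Lambda\<close> equals
    1, so the inner coefficient -1 just meets the bound.\<close>
  have "trinomial \<in> D_single 1 {pt 0, pt 2} (pt 1)"
    unfolding D_single_def trinomial_def mem_Collect_eq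
    by (intro exI[of _ "\<lambda>_. 1"] exI[of _ "-1"]) (simp add: rpow_def cong: if_cong)
  moreover have "pt 1 \<in> convex hull {pt 0, pt 2}"
    unfolding convex_hull_2 mem_Collect_eq
    by (intro exI[of _ "1/2"]) (simp add: pt_scaleR pt_add)
  moreover have "pt 1 \<in> {pt 0, pt 1, pt 2} - {pt 0, pt 2}"
    by (simp add: pt_eq_iff)
  ultimately show ?thesis
    by (intro D_single_subset_DSONC[THEN subsetD, of "{pt 0, pt 2}" _ "pt 1"]) auto
qed

lemma sum_grid: "{pt 0, pt 1, pt 2} + {pt 0, pt 1, pt 2} = grid"
proof -
  have "{0..4} = {0, 1, 2, 3, 4 :: nat}"
    by auto
  then show ?thesis
    by (auto simp: grid_def set_plus_def pt_add pt_eq_iff)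
qed

lemma trinomial_square_exp_sum: "trinomial * trinomial \<in> exp_sums 1 grid"
proof -
  \<comment> \<open>The coefficients of the square, looked up by the integer coordinate of the
    exponent.\<close>
  define c where "c = (\<lambda>\<alpha> :: point. [1, -2, 3, -2, 1 :: real] ! nat \<lfloor>\<alpha> 0\<rfloor>)"
  have c: "c (pt (real k)) = [1, -2, 3, -2, 1] ! k" for k
    by (simp add: c_def pt_def)
  have set: "{0..4} = {0, 1, 2, 3, 4 :: nat}"
    by auto
  have square: "(1 - t + t ^ 2) * (1 - t + t ^ 2) = 1 - 2 * t + 3 * t ^ 2 - 2 * t ^ 3 + t ^ 4"
    for t :: real
    by algebra
  have "inj_on (\<lambda>k. pt (real k)) {0..4}"
    by (auto simp: inj_on_def pt_eq_iff)
  then have "(\<Sum>\<alpha>\<in>grid. c \<alpha> *\<^sub>R exp_monomial 1 \<alpha>)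
      = (\<Sum>k=0..4. c (pt (real k)) *\<^sub>R exp_monomial 1 (pt (real k)))"
    by (simp add: grid_def sum.reindex)
  also have "\<dots> = trinomial * trinomial"
  proof
    fix x
    have "(\<Sum>k=0..4. c (pt (real k)) *\<^sub>R exp_monomial 1 (pt (real k))) x
        = (\<Sum>k=0..4. c (pt (real k)) * exp_monomial 1 (pt (real k)) x)"
      by (simp add: sum_fun_apply scaleR_fun_def)
    also have "\<dots> = (trinomial * trinomial) x"
      using set square by (simp add: exp_monomial_pt c trinomial_apply)
    finally show "(\<Sum>k=0..4. c (pt (real k)) *\<^sub>R exp_monomial 1 (pt (real k))) x
        = (trinomial * trinomial) x" .
  qed
  finally show ?thesis
    unfolding exp_sums_def mem_Collect_eq by (intro exI[of _ c]) simp
qed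

text \<open>At the nodes 1 to 5 the trinomial takes the values 1, 3, 7, 13, 21, whose squares enter
  the weighted sum.\<close>

lemma sep_trinomial_square: "sep (trinomial * trinomial) = -40"
proof -
  have "trinomial (pt (ln t)) = 1 - t + t ^ 2" if "0 < t" for t
    using that by (simp add: trinomial_apply pt_in_Rn) (simp add: pt_def)
  then show ?thesis
    \<comment> \<open>Without \<open>ln_one\<close>, the node \<open>ln 1\<close> keeps the form
      \<open>ln t\<close> that the evaluation fact matches.\<close>
    by (simp add: sep_def del: ln_one)
qed

theorem proposition4p16:
  shows "\<exists>(n::nat) A1 A2 f1 f2. n \<ge> 1 \<and>
    finite A1 \<and> A1 \<subseteq> Rn n \<and> finite A2 \<and> A2 \<subseteq> Rn n \<and>
    f1 \<in> DSONC n A1 \<and> f2 \<in> DSONC n A2 \<and>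
    f1 * f2 \<in> exp_sums n (A1 + A2) \<and> f1 * f2 \<notin> DSONC n (A1 + A2)"
proof -
  let ?A = "{pt 0, pt 1, pt 2}"
  have "trinomial * trinomial \<notin> DSONC 1 (?A + ?A)"
    using sep_DSONC_nonneg[of "trinomial * trinomial"] sep_trinomial_square
    unfolding sum_grid by auto
  moreover have "trinomial * trinomial \<in> exp_sums 1 (?A + ?A)"
    unfolding sum_grid by (rule trinomial_square_exp_sum)
  moreover have "?A \<subseteq> Rn 1"
    using pt_in_Rn by blast
  ultimately show ?thesis
    using trinomial_in_DSONC
    by (intro exI[of _ 1] exI[of _ ?A] exI[of _ trinomial]) simp
qed

end
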